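(* Let $\rho>0$ and let $r_n^\delta:X_n\to\mathbb{R}$ be twice continuously differentiable with Lipschitz continuous second derivative, i.e. there is $L>0$ with $$\|{r_n^\delta}''(x)-{r_n^\delta}''(\tilde{x})\|_n\le L\|x-\tilde{x}\|_n\quad\text{for all }x,\tilde{x}\in X_n.$$ Let $x_{n,\rho}^\delta$ be a minimizer of $r_n^\delta$ over $\{x_n\in X_n:\|x_n\|_n^2\le\rho\}$ at which the bilinear form $${r_n^\delta}''(x_{n,\rho}^\delta)+\lambda_\rho I_n\ \text{ is positive definite on }X_n,\quad\text{where }\lambda_\rho=-\frac{{r_n^\delta}'(x_{n,\rho}^\delta)\,x_{n,\rho}^\delta}{\rho}.$$ For a starting point $x_n^0\in X_n$ let the iterates $x_n^{k+1}$, $k=0,1,2,\dots$, be defined as (global) minimizers of the quadratic function $$q^k(x)=r_n^\delta(x_n^k)+{r_n^\delta}'(x_n^k)(x-x_n^k)+\tfrac12{r_n^\delta}''(x_n^k)(x-x_n^k)^2$$ over $\{x\in X_n:\|x\|_n^2\le\rho\}$. Then the iterates converge locally quadratically to $x_{n,\rho}^\delta$: there exist $\epsilon>0$ and $c>0$ such that whenever $\|x_n^0-x_{n,\rho}^\delta\|_n<\epsilon$, one has $x_n^k\to x_{n,\rho}^\delta$ as $k\to\infty$ and $$\|x_n^{k+1}-x_{n,\rho}^\delta\|_n\le c\,\|x_n^k-x_{n,\rho}^\delta\|_n^2\quad\text{for all }k\ge 0.$$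
   Context: $X_n$ is a finite-dimensional real vector space with inner product $\langle\cdot,\cdot\rangle_n$ and induced norm $\|\cdot\|_n$ (also used for the induced norm of bilinear forms on $X_n$). $I_n:X_n\times X_n\to\mathbb{R}$ is the bilinear form $I_n(x,\tilde{x})=\langle x,\tilde{x}\rangle_n$. In the paper $r_n^\delta(x_n)=\mathcal{S}_n(F_n(x_n),y^\delta)$, with $F_n:X_n\to Y$ a discretized forward operator into a Banach space $Y$, $\mathcal{S}_n:Y\times Y\to\mathbb{R}$ a distance measure and $y^\delta\in Y$ fixed data. First and second derivatives ${r_n^\delta}'(x)$, ${r_n^\delta}''(x)$ are regarded as a linear form and a symmetric bilinear form on $X_n$; ${r_n^\delta}''(x)w^2$ denotes ${r_n^\delta}''(x)(w,w)$. *)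

theory Defs
  imports "HOL-Analysis.Analysis"
begin

definition feasible_set :: "real \<Rightarrow> 'a::real_normed_vector set" where
  "feasible_set \<rho> = {x. (norm x)\<^sup>2 \<le> \<rho>}"

definition minimizer_on :: "('a \<Rightarrow> real) \<Rightarrow> 'a set \<Rightarrow> 'a \<Rightarrow> bool" where
  "minimizer_on f S x \<longleftrightarrow> is_arg_min f (\<lambda>z. z \<in> S) x"

definition positive_definite :: "('a::real_vector \<Rightarrow> 'a \<Rightarrow> real) \<Rightarrow> bool" where
  "positive_definite B \<longleftrightarrow> (\<forall>v. v \<noteq> 0 \<longrightarrow> B v v > 0)"

(* Derivatives are bounded linear maps: r1 x is the linear form r'(x), and r2 x is the bilinear
   form r''(x) in curried form, so that r''(x)(v, w) is r2 x v w. The operator norm of r2 x is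
   the least C with |r''(x)(v, w)| <= C * norm v * norm w for all v, w, i.e. the induced norm
   of the bilinear form. Symmetry of r2 x follows from the continuity of r2. *)
definition twice_continuously_differentiable ::
  "('a::real_normed_vector \<Rightarrow> real) \<Rightarrow> ('a \<Rightarrow> 'a \<Rightarrow>\<^sub>L real) \<Rightarrow> ('a \<Rightarrow> 'a \<Rightarrow>\<^sub>L 'a \<Rightarrow>\<^sub>L real) \<Rightarrow> bool"
where
  "twice_continuously_differentiable r r1 r2 \<longleftrightarrow>
     (\<forall>x. (r has_derivative blinfun_apply (r1 x)) (at x)) \<and>
     (\<forall>x. (r1 has_derivative blinfun_apply (r2 x)) (at x)) \<and>
     continuous_on UNIV r2"

definition quadratic_model ::
  "('a::real_normed_vector \<Rightarrow> real) \<Rightarrow> ('a \<Rightarrow> 'a \<Rightarrow>\<^sub>L real) \<Rightarrow> ('a \<Rightarrow> 'a \<Rightarrow>\<^sub>L 'a \<Rightarrow>\<^sub>L real) \<Rightarrow>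
     'a \<Rightarrow> 'a \<Rightarrow> real"
where
  "quadratic_model r r1 r2 y x =
     r y + blinfun_apply (r1 y) (x - y)
       + (1/2) * blinfun_apply (blinfun_apply (r2 y) (x - y)) (x - y)"

(* The starting point x 0 need not be feasible. *)
definition sqp_iterates ::
  "('a::real_normed_vector \<Rightarrow> real) \<Rightarrow> ('a \<Rightarrow> 'a \<Rightarrow>\<^sub>L real) \<Rightarrow> ('a \<Rightarrow> 'a \<Rightarrow>\<^sub>L 'a \<Rightarrow>\<^sub>L real) \<Rightarrow>
     real \<Rightarrow> (nat \<Rightarrow> 'a) \<Rightarrow> bool"
where
  "sqp_iterates r r1 r2 \<rho> x \<longleftrightarrow>
     (\<forall>k. minimizer_on (quadratic_model r r1 r2 (x k)) (feasible_set \<rho>) (x (Suc k)))"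

end

theory Submission
  imports Defs
begin

text \<open>
The proof compares values of the quadratic models instead of their optimality conditions.
Write \<open>x*\<close> for the given minimizer, \<open>y\<close> for the current iterate, \<open>z\<close> for the next one,
and put \<open>e = norm (y - x*)\<close> and \<open>s = norm (z - x*)\<close>.

At \<open>x*\<close> the derivative of \<open>r\<close> is \<open>- \<lambda> * \<langle>x*, _\<rangle>\<close> with a multiplier \<open>\<lambda> \<ge> 0\<close> that vanishes
unless \<open>x*\<close> lies on the sphere (\<open>ball_multiplier\<close>). Since
\<open>2 * \<langle>x*, z - x*\<rangle> = norm z ^ 2 - norm x* ^ 2 - norm (z - x*) ^ 2\<close>, on the ball this gives
\<open>r'(x*)(z - x*) \<ge> \<lambda>/2 * norm (z - x*) ^ 2\<close>. The positive definite form
\<open>r''(x*) + \<lambda> I\<close> therefore makes the model built at \<open>x*\<close> exceed its value at \<open>x*\<close> by at least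
\<open>\<alpha>/2 * s ^ 2\<close>, for every feasible \<open>z\<close> and not just for those near \<open>x*\<close>
(\<open>model_quadratic_growth\<close>). This is why global minimizers of the models stay close to \<open>x*\<close>.

The model built at \<open>y\<close> differs from the one built at \<open>x*\<close> by a quadratic function whose gradient
at \<open>x*\<close> is the linearization error \<open>r'(y) - r'(x*) - r''(y)(y - x*)\<close>, of size at most
\<open>L * e ^ 2\<close>, and whose Hessian has norm at most \<open>L * e\<close>. As \<open>z\<close> does at least as well as \<open>x*\<close>
for the model at \<open>y\<close>, the growth estimate gives \<open>\<alpha>/2 * s ^ 2 \<le> L * e ^ 2 * s + L/2 * e * s ^ 2\<close>,
hence \<open>s \<le> 4 * L/\<alpha> * e ^ 2\<close> once \<open>L * e \<le> \<alpha>/2\<close> (\<open>sqp_step\<close>). Such a quadratic recursion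
contracts to zero from a small enough start (\<open>quadratic_recursion_tendsto_zero\<close>).

To read off the gradient of the model at \<open>x*\<close> the bilinear form \<open>r''(y)\<close> must be symmetric;
this is the theorem of Schwarz, \<open>second_derivative_symmetric\<close>.
\<close>

section \<open>Symmetry of the second derivative\<close>

text \<open>
The second difference is an increment of \<open>s \<mapsto> f (x + s v + t w) - f (x + s v)\<close> over \<open>[0, t]\<close>. By the
mean value theorem it is \<open>t\<close> times a difference of first derivatives in the direction \<open>v\<close>, and
differentiability of \<open>f'\<close> at \<open>x\<close> replaces that difference by \<open>t * H w v\<close>.
\<close>

lemma second_difference_estimate:
  fixes f :: "'a::real_normed_vector \<Rightarrow> real"
    and f' :: "'a \<Rightarrow> 'a \<Rightarrow>\<^sub>L real" and H :: "'a \<Rightarrow> 'a \<Rightarrow>\<^sub>L real"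
  assumes f: "\<And>y. (f has_derivative blinfun_apply (f' y)) (at y)"
    and f': "(f' has_derivative H) (at x)"
    and "e > 0"
  shows "\<exists>d>0. \<forall>t. 0 < t \<and> t < d \<longrightarrow>
    \<bar>f (x + t *\<^sub>R v + t *\<^sub>R w) - f (x + t *\<^sub>R v) - f (x + t *\<^sub>R w) + f x - t\<^sup>2 * H w v\<bar> \<le> e * t\<^sup>2"
proof -
  interpret H: bounded_linear H by (rule has_derivative_bounded_linear[OF f'])
  \<comment> \<open>Applied to \<open>v\<close>, the two linearization errors of \<open>f'\<close> below add up to at most \<open>\<eta> * t * (C - 1)\<close>, while
    \<open>t * K < d\<close> keeps the evaluation points within distance \<open>d\<close> of \<open>x\<close>. Adding 1 keeps
    \<open>C\<close> and \<open>K\<close> positive when \<open>v\<close> and \<open>w\<close> vanish.\<close>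
  define C where "C = (2 * norm v + norm w) * norm v + 1"
  have "C > 0" unfolding C_def by (intro add_nonneg_pos mult_nonneg_nonneg) auto
  define \<eta> where "\<eta> = e / C"
  have "\<eta> > 0" unfolding \<eta>_def using \<open>C > 0\<close> \<open>e > 0\<close> by simp
  obtain d where "d > 0"
    and d: "\<And>y. norm (y - x) < d \<Longrightarrow> norm (f' y - f' x - H (y - x)) \<le> \<eta> * norm (y - x)"
    using f'[unfolded has_derivative_at_alt] \<open>\<eta> > 0\<close> by blast
  define K where "K = norm v + norm w + 1"
  have "K > 0" unfolding K_def by (intro add_nonneg_pos) auto
  show ?thesis
  proof (intro exI[of _ "d / K"] conjI allI impI)
    show "d / K > 0" using \<open>d > 0\<close> \<open>K > 0\<close> by simp
    fix t :: real assume t: "0 < t \<and> t < d / K"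
    define g where "g s = f (x + s *\<^sub>R v + t *\<^sub>R w) - f (x + s *\<^sub>R v)" for s
    define g' where "g' s = f' (x + s *\<^sub>R v + t *\<^sub>R w) v - f' (x + s *\<^sub>R v) v" for s
    have "(g has_real_derivative g' s) (at s)" for s
      unfolding g_def g'_def has_field_derivative_def
      by (rule derivative_eq_intros f[THEN has_derivative_compose[rotated]] refl)+
         (simp add: fun_eq_iff blinfun.scaleR_right algebra_simps)
    then obtain s where s: "0 < s" "s < t" and g: "g t - g 0 = (t - 0) * g' s"
      using MVT2[of 0 t g g'] t by auto
    have tK: "t * K < d" using t \<open>K > 0\<close> by (simp add: pos_less_divide_eq)
    have 1: "norm (s *\<^sub>R v + t *\<^sub>R w) \<le> t * (norm v + norm w)"
    proof -
      have "norm (s *\<^sub>R v + t *\<^sub>R w) \<le> s * norm v + t * norm w"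
        using norm_triangle_ineq[of "s *\<^sub>R v" "t *\<^sub>R w"] s t by simp
      also have "\<dots> \<le> t * norm v + t * norm w"
        using s by (simp add: mult_right_mono)
      finally show ?thesis by (simp add: algebra_simps)
    qed
    have 2: "norm (s *\<^sub>R v) \<le> t * norm v" using s by (simp add: mult_right_mono)
    have le: "t * (norm v + norm w) < d" "t * norm v < d"
      using tK t by (auto simp: K_def algebra_simps intro: le_less_trans[rotated])
    let ?E = "\<lambda>u. f' (x + u) - f' x - H u"
    have E1: "norm (?E (s *\<^sub>R v + t *\<^sub>R w)) \<le> \<eta> * (t * (norm v + norm w))"
      using d[of "x + (s *\<^sub>R v + t *\<^sub>R w)"] 1 le \<open>\<eta> > 0\<close>
      by (smt (verit) add_diff_cancel_left' mult_left_mono)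
    have E2: "norm (?E (s *\<^sub>R v)) \<le> \<eta> * (t * norm v)"
      using d[of "x + s *\<^sub>R v"] 2 le \<open>\<eta> > 0\<close>
      by (smt (verit) add_diff_cancel_left' mult_left_mono)
    have "g' s - t * H w v = (?E (s *\<^sub>R v + t *\<^sub>R w) - ?E (s *\<^sub>R v)) v"
      by (simp add: g'_def H.add H.scaleR blinfun.bilinear_simps add.assoc)
    also have "norm \<dots> \<le> norm (?E (s *\<^sub>R v + t *\<^sub>R w) - ?E (s *\<^sub>R v)) * norm v"
      by (rule norm_blinfun)
    also have "\<dots> \<le> (\<eta> * (t * (norm v + norm w)) + \<eta> * (t * norm v)) * norm v"
      by (intro mult_right_mono order.trans[OF norm_triangle_ineq4 add_mono[OF E1 E2]]) simp
    also have "\<dots> = \<eta> * t * (C - 1)" by (simp add: C_def algebra_simps)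
    also have "\<dots> \<le> \<eta> * t * C" using \<open>\<eta> > 0\<close> t by (intro mult_left_mono) auto
    also have "\<dots> = e * t" using \<open>C > 0\<close> by (simp add: \<eta>_def)
    finally have *: "\<bar>g' s - t * H w v\<bar> \<le> e * t" by simp
    have "f (x + t *\<^sub>R v + t *\<^sub>R w) - f (x + t *\<^sub>R v) - f (x + t *\<^sub>R w) + f x - t\<^sup>2 * H w v
        = t * (g' s - t * H w v)"
      using g by (simp add: g_def power2_eq_square algebra_simps)
    also have "\<bar>\<dots>\<bar> \<le> t * (e * t)" using * t by (simp add: abs_mult)
    finally show "\<bar>f (x + t *\<^sub>R v + t *\<^sub>R w) - f (x + t *\<^sub>R v) - f (x + t *\<^sub>R w) + f x - t\<^sup>2 * H w v\<bar> \<le> e * t\<^sup>2"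
      by (simp add: power2_eq_square mult_ac)
  qed
qed

text \<open>
The second difference does not change when \<open>v\<close> and \<open>w\<close> are exchanged, so its two approximations
\<open>t\<^sup>2 * H w v\<close> and \<open>t\<^sup>2 * H v w\<close> agree up to \<open>o(t\<^sup>2)\<close>.
\<close>

lemma second_derivative_symmetric:
  fixes f :: "'a::real_normed_vector \<Rightarrow> real"
    and f' :: "'a \<Rightarrow> 'a \<Rightarrow>\<^sub>L real" and H :: "'a \<Rightarrow> 'a \<Rightarrow>\<^sub>L real"
  assumes f: "\<And>y. (f has_derivative blinfun_apply (f' y)) (at y)"
    and f': "(f' has_derivative H) (at x)"
  shows "H v w = H w v"
proof -
  have "\<bar>H v w - H w v\<bar> \<le> 0 + e" if "e > 0" for e
  proof -
    let ?D = "\<lambda>v w t. f (x + t *\<^sub>R v + t *\<^sub>R w) - f (x + t *\<^sub>R v) - f (x + t *\<^sub>R w) + f x"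
    have "e / 2 > 0" using that by simp
    obtain d1 where "d1 > 0"
      and d1: "\<And>t. 0 < t \<Longrightarrow> t < d1 \<Longrightarrow> \<bar>?D v w t - t\<^sup>2 * H w v\<bar> \<le> e / 2 * t\<^sup>2"
      using second_difference_estimate[OF f f' \<open>e / 2 > 0\<close>, of v w] by blast
    obtain d2 where "d2 > 0"
      and d2: "\<And>t. 0 < t \<Longrightarrow> t < d2 \<Longrightarrow> \<bar>?D w v t - t\<^sup>2 * H v w\<bar> \<le> e / 2 * t\<^sup>2"
      using second_difference_estimate[OF f f' \<open>e / 2 > 0\<close>, of w v] by blast
    obtain t where t: "0 < t" "t < d1" "t < d2"
      using \<open>d1 > 0\<close> \<open>d2 > 0\<close> field_lbound_gt_zero by blast
    have "?D v w t = ?D w v t" by (simp add: algebra_simps)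
    then have "\<bar>t\<^sup>2 * H v w - t\<^sup>2 * H w v\<bar> \<le> e * t\<^sup>2"
      using d1[OF t(1,2)] d2[OF t(1,3)] unfolding abs_le_iff by linarith
    also have "t\<^sup>2 * H v w - t\<^sup>2 * H w v = (H v w - H w v) * t\<^sup>2" by (simp add: algebra_simps)
    finally have "\<bar>H v w - H w v\<bar> * t\<^sup>2 \<le> e * t\<^sup>2" by (simp add: abs_mult)
    then show ?thesis using t by simp
  qed
  then have "\<bar>H v w - H w v\<bar> \<le> 0" by (rule field_le_epsilon)
  then show ?thesis by simp
qed

section \<open>Optimality on the ball\<close>

lemma minimizer_on_convex_variational_inequality:
  fixes f :: "'a::real_normed_vector \<Rightarrow> real"
  assumes min: "minimizer_on f S x" and "convex S" and "z \<in> S"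
    and der: "(f has_derivative f') (at x)"
  shows "f' (z - x) \<ge> 0"
proof (rule ccontr)
  assume neg: "\<not> f' (z - x) \<ge> 0"
  interpret f': bounded_linear f' by (rule has_derivative_bounded_linear[OF der])
  have "x \<in> S" using min by (simp add: minimizer_on_def is_arg_min_def)
  let ?g = "\<lambda>t. f (x + t *\<^sub>R (z - x))"
  have "((\<lambda>t. x + t *\<^sub>R (z - x)) has_derivative (\<lambda>t. t *\<^sub>R (z - x))) (at 0)"
    by (auto intro!: derivative_eq_intros)
  from has_derivative_compose[OF this, of f f'] der
  have "(?g has_real_derivative f' (z - x)) (at 0)"
    by (simp add: has_field_derivative_def f'.scaleR mult.commute[of _ "f' (z - x)"])
  then obtain d where "d > 0" and d: "\<And>h. 0 < h \<Longrightarrow> h < d \<Longrightarrow> ?g h < f x"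
    using DERIV_neg_dec_right[of ?g "f' (z - x)" 0] neg by auto
  obtain h where h: "0 < h" "h < d" "h < 1"
    using \<open>d > 0\<close> field_lbound_gt_zero[of d 1] by auto
  have "x + h *\<^sub>R (z - x) = (1 - h) *\<^sub>R x + h *\<^sub>R z" by (simp add: algebra_simps)
  also have "\<dots> \<in> S" using \<open>convex S\<close> \<open>x \<in> S\<close> \<open>z \<in> S\<close> h by (simp add: convex_alt)
  finally show False using d[of h] h min by (force simp: minimizer_on_def is_arg_min_def)
qed

lemma feasible_set_eq_cball:
  assumes "\<rho> > 0"
  shows "feasible_set \<rho> = cball 0 (sqrt \<rho>)"
  using assms by (auto simp: feasible_set_def real_le_rsqrt sqrt_ge_absD)

text \<open>
The first-order conditions on the ball, for points inside and on the sphere alike. Let \<open>G\<close>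
be the gradient that represents \<open>g\<close>. The feasible point in direction \<open>-G\<close> gives
\<open>norm G \<le> \<mu> * sqrt \<rho>\<close>. Expanding the square then shows
\<open>norm (G + \<mu> x) ^ 2 + \<mu> ^ 2 * (\<rho> - norm x ^ 2) \<le> 0\<close>. Both summands are nonnegative, so both vanish:
the first is stationarity, the second complementary slackness.
\<close>

lemma ball_multiplier:
  fixes x :: "'a::euclidean_space"
  assumes "\<rho> > 0" and g: "linear g"
    and "x \<in> feasible_set \<rho>"
    and vi: "\<And>z. z \<in> feasible_set \<rho> \<Longrightarrow> g (z - x) \<ge> 0"
  defines "\<mu> \<equiv> - (g x / \<rho>)"
  shows "g v = - \<mu> * (x \<bullet> v)" and "\<mu> \<ge> 0" and "\<mu> * (\<rho> - (norm x)\<^sup>2) = 0"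
proof -
  define G where "G = adjoint g 1"
  have gG: "g v = G \<bullet> v" for v
    using adjoint_works[OF g, of v 1] by (simp add: G_def inner_commute)
  have x: "(norm x)\<^sup>2 \<le> \<rho>" using assms by (simp add: feasible_set_def)
  have gx: "g x = - (\<mu> * \<rho>)" using \<open>\<rho> > 0\<close> by (simp add: \<mu>_def)
  have "g (0 - x) \<ge> 0" using \<open>\<rho> > 0\<close> by (intro vi) (simp add: feasible_set_def)
  then show mu: "\<mu> \<ge> 0"
    using linear_neg[OF g, of x] \<open>\<rho> > 0\<close> by (simp add: gx zero_le_mult_iff)
  have "norm G \<le> \<mu> * sqrt \<rho>"
  proof (cases "G = 0")
    case True
    then show ?thesis using mu \<open>\<rho> > 0\<close> by simp
  next
    case False
    \<comment> \<open>\<open>z\<close> minimizes \<open>g\<close> over the ball.\<close>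
    define z where "z = - (sqrt \<rho> / norm G) *\<^sub>R G"
    have "norm z = sqrt \<rho>" using False \<open>\<rho> > 0\<close> by (simp add: z_def)
    then have "g (z - x) \<ge> 0" using \<open>\<rho> > 0\<close> by (intro vi) (simp add: feasible_set_def)
    moreover have "G \<bullet> z = - sqrt \<rho> * norm G"
      using False by (simp add: z_def dot_square_norm power2_eq_square)
    ultimately have "sqrt \<rho> * norm G \<le> sqrt \<rho> * (\<mu> * sqrt \<rho>)"
      using gx \<open>\<rho> > 0\<close> by (simp add: gG inner_diff_right algebra_simps)
    then show ?thesis using \<open>\<rho> > 0\<close> by simp
  qed
  then have "(norm G)\<^sup>2 \<le> (\<mu> * sqrt \<rho>)\<^sup>2" by (intro power_mono) auto
  then have G2: "(norm G)\<^sup>2 \<le> \<mu>\<^sup>2 * \<rho>" using \<open>\<rho> > 0\<close> by (simp add: power_mult_distrib)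
  have "(norm (G + \<mu> *\<^sub>R x))\<^sup>2 = (norm G)\<^sup>2 + 2 * \<mu> * g x + \<mu>\<^sup>2 * (norm x)\<^sup>2"
    unfolding power2_norm_eq_inner gG
    by (simp add: inner_add_left inner_add_right inner_commute[of x G] power2_eq_square
        algebra_simps)
  then have sum: "(norm (G + \<mu> *\<^sub>R x))\<^sup>2 + \<mu>\<^sup>2 * (\<rho> - (norm x)\<^sup>2) \<le> 0"
    using G2 by (simp add: gx power2_eq_square algebra_simps)
  have nn: "\<mu>\<^sup>2 * (\<rho> - (norm x)\<^sup>2) \<ge> 0" using x by simp
  have "(norm (G + \<mu> *\<^sub>R x))\<^sup>2 = 0" using sum nn zero_le_power2[of "norm (G + \<mu> *\<^sub>R x)"] by linarith
  then have "G = - \<mu> *\<^sub>R x" by (simp add: eq_neg_iff_add_eq_0)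
  then show "g v = - \<mu> * (x \<bullet> v)" by (simp add: gG)
  have "\<mu>\<^sup>2 * (\<rho> - (norm x)\<^sup>2) = 0" using sum nn zero_le_power2[of "norm (G + \<mu> *\<^sub>R x)"] by linarith
  then show "\<mu> * (\<rho> - (norm x)\<^sup>2) = 0" by simp
qed

text \<open>
By homogeneity it is enough to bound \<open>Q\<close> from below on the unit sphere, which is compact.
\<close>

lemma positive_quadratic_form_coercive:
  fixes Q :: "'a::euclidean_space \<Rightarrow> real"
  assumes "continuous_on UNIV Q" and hom: "\<And>a v. Q (a *\<^sub>R v) = a\<^sup>2 * Q v"
    and pos: "\<And>v. v \<noteq> 0 \<Longrightarrow> Q v > 0"
  shows "\<exists>\<alpha>>0. \<forall>v. \<alpha> * (norm v)\<^sup>2 \<le> Q v"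
proof -
  have "continuous_on (sphere 0 1) Q" using assms(1) by (rule continuous_on_subset) simp
  moreover have "compact (sphere (0::'a) 1)" "sphere (0::'a) 1 \<noteq> {}" by simp_all
  ultimately obtain u where u: "u \<in> sphere 0 1" and le: "\<And>v. v \<in> sphere 0 1 \<Longrightarrow> Q u \<le> Q v"
    using continuous_attains_inf[of "sphere 0 1" Q] by blast
  have "Q u * (norm v)\<^sup>2 \<le> Q v" for v
  proof (cases "v = 0")
    case True
    then show ?thesis using hom[of 0 v] by simp
  next
    case False
    define w where "w = (1 / norm v) *\<^sub>R v"
    have "v = norm v *\<^sub>R w" and "norm w = 1" using False by (simp_all add: w_def)
    then have "Q v = (norm v)\<^sup>2 * Q w" using hom by metis
    then show ?thesis using le[of w] \<open>norm w = 1\<close> by (simp add: mult.commute mult_right_mono)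
  qed
  moreover have "Q u > 0" using u by (intro pos) auto
  ultimately show ?thesis by blast
qed

section \<open>One step of the iteration\<close>

text \<open>
The bilinear form \<open>B\<close> alone may be indefinite; the missing term \<open>\<mu> * norm (z - x) ^ 2\<close> comes from the
curvature of the ball. By the identity for \<open>\<langle>x, z - x\<rangle>\<close> below, \<open>g (z - x)\<close> equals
\<open>\<mu>/2 * norm (z - x) ^ 2\<close> plus \<open>\<mu>/2 * (norm x ^ 2 - norm z ^ 2)\<close>, and complementarity turns the latter
into \<open>\<mu>/2 * (\<rho> - norm z ^ 2) \<ge> 0\<close>.
\<close>

lemma model_quadratic_growth:
  fixes x z :: "'a::euclidean_space"
  assumes g: "\<And>v. g v = - \<mu> * (x \<bullet> v)" and "\<mu> \<ge> 0" and "\<mu> * (\<rho> - (norm x)\<^sup>2) = 0"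
    and coercive: "\<And>v. \<alpha> * (norm v)\<^sup>2 \<le> B v v + \<mu> * (v \<bullet> v)"
    and "z \<in> feasible_set \<rho>"
  shows "\<alpha> / 2 * (norm (z - x))\<^sup>2 \<le> g (z - x) + 1/2 * B (z - x) (z - x)"
proof -
  have "2 * (x \<bullet> (z - x)) = (norm z)\<^sup>2 - (norm x)\<^sup>2 - (z - x) \<bullet> (z - x)"
    by (simp add: power2_norm_eq_inner inner_diff_left inner_diff_right inner_commute)
  then have "\<mu> * (2 * (x \<bullet> (z - x))) = \<mu> * ((norm z)\<^sup>2 - (norm x)\<^sup>2 - (z - x) \<bullet> (z - x))"
    by simp
  moreover have "\<mu> * (\<rho> - (norm z)\<^sup>2) \<ge> 0"
    using assms by (simp add: feasible_set_def)
  ultimately have "2 * (\<mu> * (x \<bullet> (z - x))) \<le> - (\<mu> * ((z - x) \<bullet> (z - x)))"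
    using assms(3) unfolding right_diff_distrib by linarith
  then show ?thesis using coercive[of "z - x"] by (simp add: g)
qed

text \<open>
The mean value inequality for \<open>f - f' y\<close> on the segment, where \<open>f'\<close> deviates from \<open>f' y\<close> by at most
\<open>L * norm (y - x)\<close>. Integrating along the segment would improve the constant to \<open>L / 2\<close>.
\<close>

lemma derivative_linearization_error:
  fixes f :: "'a::real_normed_vector \<Rightarrow> 'b::real_normed_vector" and f' :: "'a \<Rightarrow> 'a \<Rightarrow>\<^sub>L 'b"
  assumes f: "\<And>x. (f has_derivative blinfun_apply (f' x)) (at x)"
    and lip: "\<And>x y. norm (f' x - f' y) \<le> L * norm (x - y)" and "L > 0"
  shows "norm (f y - f x - f' y (y - x)) \<le> L * (norm (y - x))\<^sup>2"
proof -
  have "norm (f y - f x - f' y (y - x)) \<le> norm (y - x) * (L * norm (y - x))"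
  proof (rule differentiable_bound_linearization[where S = "closed_segment x y"])
    fix z assume "z \<in> closed_segment x y"
    then have "norm (z - y) \<le> norm (y - x)"
      using segment_bound(2)[of z x y] by (simp add: norm_minus_commute)
    then have "norm (f' z - f' y) \<le> L * norm (y - x)"
      using lip[of z y] \<open>L > 0\<close> by (meson mult_left_mono order.trans less_imp_le)
    then show "onorm (blinfun_apply (f' z) - blinfun_apply (f' y)) \<le> L * norm (y - x)"
      by (simp add: norm_blinfun.rep_eq minus_blinfun.rep_eq fun_diff_def)
  next
    show "x + t *\<^sub>R (y - x) \<in> closed_segment x y" if "t \<in> {0..1}" for t
      using that by (auto simp: closed_segment_def algebra_simps intro!: exI[of _ t])
  qed (auto intro: has_derivative_at_withinI[OF f])
  then show ?thesis by (simp add: power2_eq_square mult_ac)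
qed

text \<open>
The model built at \<open>y\<close>, expanded around another point \<open>x\<close>. Symmetry merges the two mixed terms
into the gradient.
\<close>

lemma quadratic_model_difference:
  fixes r2 :: "'a::real_normed_vector \<Rightarrow> 'a \<Rightarrow>\<^sub>L 'a \<Rightarrow>\<^sub>L real"
  assumes "\<And>v w. r2 y v w = r2 y w v"
  shows "quadratic_model r r1 r2 y z - quadratic_model r r1 r2 y x
    = (r1 y - r2 y (y - x)) (z - x) + 1/2 * r2 y (z - x) (z - x)"
proof -
  define u v where "u = z - x" and "v = x - y"
  have z: "z - y = u + v" "y - x = - v" "x - y = v" "z - x = u" by (simp_all add: u_def v_def)
  show ?thesis
    unfolding quadratic_model_def z
    using assms[of u v] by (simp add: blinfun.bilinear_simps algebra_simps)
qed

text \<open>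
The minimizing property of \<open>z\<close> enters only through the comparison with \<open>x\<close>, and quadratic growth
converts the bound on values into one on the distance: both error terms carry a factor
\<open>norm (z - x)\<close>, which cancels, and \<open>near\<close> lets the left-hand side absorb the second one.
\<close>

lemma sqp_step:
  fixes r :: "'a::real_normed_vector \<Rightarrow> real"
    and r1 :: "'a \<Rightarrow> 'a \<Rightarrow>\<^sub>L real" and r2 :: "'a \<Rightarrow> 'a \<Rightarrow>\<^sub>L 'a \<Rightarrow>\<^sub>L real"
  assumes der: "\<And>x. (r1 has_derivative blinfun_apply (r2 x)) (at x)"
    and sym: "\<And>x v w. r2 x v w = r2 x w v"
    and lip: "\<And>x y. norm (r2 x - r2 y) \<le> L * norm (x - y)" and "L > 0"
    and "\<alpha> > 0"
    and growth: "\<And>z. z \<in> S \<Longrightarrow>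
      \<alpha> / 2 * (norm (z - x))\<^sup>2 \<le> r1 x (z - x) + 1/2 * r2 x (z - x) (z - x)"
    and "x \<in> S" and min: "minimizer_on (quadratic_model r r1 r2 y) S z"
    and near: "L * norm (y - x) \<le> \<alpha> / 2"
  shows "norm (z - x) \<le> 4 * L / \<alpha> * (norm (y - x))\<^sup>2"
proof -
  define s e where "s = norm (z - x)" and "e = norm (y - x)"
  have "s \<ge> 0" by (simp add: s_def)
  have "z \<in> S" and le: "quadratic_model r r1 r2 y z \<le> quadratic_model r r1 r2 y x"
    using min \<open>x \<in> S\<close> by (auto simp: minimizer_on_def is_arg_min_linorder)
  have "\<alpha> / 2 * s\<^sup>2 \<le> r1 x (z - x) + 1/2 * r2 x (z - x) (z - x)"
    unfolding s_def by (rule growth[OF \<open>z \<in> S\<close>])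
  also have "\<dots> \<le> \<bar>(r1 y - r1 x - r2 y (y - x)) (z - x)\<bar> + 1/2 * \<bar>(r2 y - r2 x) (z - x) (z - x)\<bar>"
    using le quadratic_model_difference[of r2 y r r1 z x, OF sym]
      abs_ge_minus_self[of "(r1 y - r1 x - r2 y (y - x)) (z - x)"]
      abs_ge_minus_self[of "(r2 y - r2 x) (z - x) (z - x)"]
    unfolding blinfun.diff_left by argo
  also have "\<dots> \<le> L * e\<^sup>2 * s + 1/2 * (L * e * s * s)"
  proof (intro add_mono mult_left_mono)
    have "\<bar>(r1 y - r1 x - r2 y (y - x)) (z - x)\<bar> \<le> norm (r1 y - r1 x - r2 y (y - x)) * s"
      unfolding s_def real_norm_def[symmetric] by (rule norm_blinfun)
    also have "\<dots> \<le> L * e\<^sup>2 * s"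
      unfolding e_def
      by (intro mult_right_mono derivative_linearization_error[OF der lip \<open>L > 0\<close>] \<open>s \<ge> 0\<close>)
    finally show "\<bar>(r1 y - r1 x - r2 y (y - x)) (z - x)\<bar> \<le> L * e\<^sup>2 * s" .
    have "\<bar>(r2 y - r2 x) (z - x) (z - x)\<bar> \<le> norm ((r2 y - r2 x) (z - x)) * s"
      unfolding s_def real_norm_def[symmetric] by (rule norm_blinfun)
    also have "\<dots> \<le> norm (r2 y - r2 x) * s * s"
      unfolding s_def by (intro mult_right_mono norm_blinfun) auto
    also have "\<dots> \<le> L * e * s * s"
      unfolding e_def by (intro mult_right_mono lip \<open>s \<ge> 0\<close>)
    finally show "\<bar>(r2 y - r2 x) (z - x) (z - x)\<bar> \<le> L * e * s * s" .
  qed auto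
  also have "L * e * s * s \<le> \<alpha> / 2 * s * s"
    using near \<open>s \<ge> 0\<close> by (intro mult_right_mono) (auto simp: e_def)
  finally have "\<alpha> / 4 * s * s \<le> L * e\<^sup>2 * s" by (simp add: power2_eq_square)
  then have "s = 0 \<or> \<alpha> / 4 * s \<le> L * e\<^sup>2"
    using \<open>s \<ge> 0\<close> by (metis less_eq_real_def mult_le_cancel_right_pos)
  then have "\<alpha> * s \<le> 4 * L * e\<^sup>2" using \<open>L > 0\<close> by auto
  then show ?thesis using \<open>\<alpha> > 0\<close> by (simp add: s_def e_def field_simps)
qed

section \<open>Local quadratic convergence\<close>

text \<open>
Below the threshold \<open>1 / (2 * c)\<close> each step at least halves the value, so the sequence never
leaves the region where the step estimate is available.
\<close>

lemma quadratic_recursion_tendsto_zero: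
  fixes a :: "nat \<Rightarrow> real"
  assumes "\<And>k. a k \<ge> 0" and "c > 0" and start: "a 0 < 1 / (2 * c)"
    and step: "\<And>k. a k < 1 / (2 * c) \<Longrightarrow> a (Suc k) \<le> c * (a k)\<^sup>2"
  shows "a \<longlonglongrightarrow> 0" and "a k < 1 / (2 * c)"
proof -
  have half: "a (Suc k) \<le> a k / 2" if "a k < 1 / (2 * c)" for k
  proof -
    have "c * a k \<le> 1 / 2" using that \<open>c > 0\<close> by (simp add: field_simps)
    then have "(c * a k) * a k \<le> 1 / 2 * a k" using assms(1) by (intro mult_right_mono) auto
    then show ?thesis using step[OF that] by (simp add: power2_eq_square mult.assoc)
  qed
  have small: "a k < 1 / (2 * c)" for k
  proof (induction k)
    case 0
    show ?case by (rule start)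
  next
    case (Suc k)
    then show ?case using half[OF Suc] assms(1)[of k] by linarith
  qed
  then show "a k < 1 / (2 * c)" .
  have "a k \<le> a 0 * (1 / 2) ^ k" for k
  proof (induction k)
    case (Suc k)
    then show ?case using half[OF small, of k] by simp
  qed simp
  moreover have "(\<lambda>k. a 0 * (1 / 2) ^ k) \<longlonglongrightarrow> 0"
    by (intro tendsto_mult_right_zero LIMSEQ_realpow_zero) auto
  ultimately show "a \<longlonglongrightarrow> 0"
    using assms(1) by (intro tendsto_sandwich[of "\<lambda>_. 0" a sequentially]) auto
qed

theorem proposition3p1:
  fixes r :: "'a::euclidean_space \<Rightarrow> real"
    and r1 :: "'a \<Rightarrow> 'a \<Rightarrow>\<^sub>L real"
    and r2 :: "'a \<Rightarrow> 'a \<Rightarrow>\<^sub>L 'a \<Rightarrow>\<^sub>L real"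
    and \<rho> L lam :: real
    and xs :: 'a
  assumes "\<rho> > 0"
    and "twice_continuously_differentiable r r1 r2"
    and "L > 0"
    and "\<And>x y. norm (r2 x - r2 y) \<le> L * norm (x - y)"
    and "minimizer_on r (feasible_set \<rho>) xs"
    and "lam = - (blinfun_apply (r1 xs) xs / \<rho>)"
    and "positive_definite (\<lambda>v w. blinfun_apply (blinfun_apply (r2 xs) v) w + lam * (v \<bullet> w))"
  shows "\<exists>\<epsilon>>0. \<exists>c>0. \<forall>x :: nat \<Rightarrow> 'a.
           sqp_iterates r r1 r2 \<rho> x \<and> norm (x 0 - xs) < \<epsilon> \<longrightarrow>
             x \<longlonglongrightarrow> xs \<and> (\<forall>k. norm (x (Suc k) - xs) \<le> c * (norm (x k - xs))\<^sup>2)"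
proof -
  have r: "\<And>x. (r has_derivative blinfun_apply (r1 x)) (at x)"
    and r1: "\<And>x. (r1 has_derivative blinfun_apply (r2 x)) (at x)"
    using assms(2) by (auto simp: twice_continuously_differentiable_def)
  have xs: "xs \<in> feasible_set \<rho>"
    using assms(5) by (simp add: minimizer_on_def is_arg_min_def)
  have "convex (feasible_set \<rho> :: 'a set)"
    by (simp add: feasible_set_eq_cball[OF \<open>\<rho> > 0\<close>])
  then have vi: "r1 xs (z - xs) \<ge> 0" if "z \<in> feasible_set \<rho>" for z
    using minimizer_on_convex_variational_inequality[OF assms(5) _ that r] by blast
  have "linear (r1 xs)" by (rule bounded_linear.linear[OF blinfun.bounded_linear_right])
  note multiplier = ball_multiplier[OF \<open>\<rho> > 0\<close> this xs vi, folded assms(6)]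
  have "\<exists>\<alpha>>0. \<forall>v. \<alpha> * (norm v)\<^sup>2 \<le> r2 xs v v + lam * (v \<bullet> v)"
  proof (rule positive_quadratic_form_coercive)
    show "continuous_on UNIV (\<lambda>v. r2 xs v v + lam * (v \<bullet> v))"
      by (intro continuous_intros)
  qed (use assms(7) in \<open>auto simp: positive_definite_def blinfun.bilinear_simps
      power2_eq_square algebra_simps\<close>)
  then obtain \<alpha> where "\<alpha> > 0"
    and coercive: "\<And>v. \<alpha> * (norm v)\<^sup>2 \<le> r2 xs v v + lam * (v \<bullet> v)" by blast
  have growth: "\<alpha> / 2 * (norm (z - xs))\<^sup>2 \<le> r1 xs (z - xs) + 1/2 * r2 xs (z - xs) (z - xs)"
    if "z \<in> feasible_set \<rho>" for z
    by (rule model_quadratic_growth[where B = "\<lambda>v w. r2 xs v w", OF _ _ _ coercive that])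
       (rule multiplier, assumption)+
  define c where "c = 4 * L / \<alpha>"
  have "c > 0" using \<open>L > 0\<close> \<open>\<alpha> > 0\<close> by (simp add: c_def)
  have step: "norm (z - xs) \<le> c * (norm (y - xs))\<^sup>2"
    if "minimizer_on (quadratic_model r r1 r2 y) (feasible_set \<rho>) z" "norm (y - xs) < 1 / (2 * c)" for y z
    unfolding c_def
  proof (rule sqp_step[OF r1 _ assms(4) \<open>L > 0\<close> \<open>\<alpha> > 0\<close> growth xs that(1)])
    show "r2 x v w = r2 x w v" for x v w by (rule second_derivative_symmetric[OF r r1])
    have "L * norm (y - xs) \<le> \<alpha> / 8"
      using that(2) \<open>L > 0\<close> \<open>\<alpha> > 0\<close> by (simp add: c_def field_simps)
    then show "L * norm (y - xs) \<le> \<alpha> / 2" using \<open>\<alpha> > 0\<close> by simp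
  qed
  show ?thesis
  proof (rule exI[of _ "1 / (2 * c)"], intro exI[of _ c] conjI allI impI)
    fix x :: "nat \<Rightarrow> 'a"
    assume "sqp_iterates r r1 r2 \<rho> x \<and> norm (x 0 - xs) < 1 / (2 * c)"
    then have start: "norm (x 0 - xs) < 1 / (2 * c)"
      and it: "\<And>k. norm (x k - xs) < 1 / (2 * c) \<Longrightarrow> norm (x (Suc k) - xs) \<le> c * (norm (x k - xs))\<^sup>2"
      using step by (auto simp: sqp_iterates_def)
    note rec = quadratic_recursion_tendsto_zero[of "\<lambda>k. norm (x k - xs)" c, OF norm_ge_zero \<open>c > 0\<close> start it]
    show "x \<longlonglongrightarrow> xs" using rec(1) by (simp add: tendsto_norm_zero_iff LIM_zero_iff)
    show "norm (x (Suc k) - xs) \<le> c * (norm (x k - xs))\<^sup>2" for k using it rec(2) by blast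
  qed (use \<open>c > 0\<close> in auto)
qed

end
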